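(* Let $1\le N\le M$ be integers, let $\overline{\lambda}=(\overline{\lambda_1}\ge\cdots\ge\overline{\lambda_N}\ge 0)$ be a Young diagram with $\overline{\lambda_1}\le M-N$, let $z_1,\dots,z_N$ be free variables and $t$ a nonzero free parameter. Then $$\prod_{1\le j<k\le N}(z_j+tz_k)\,s_{\overline{\lambda}}(z_1,\dots,z_N)= t^{\sum_{j=1}^N\overline{\lambda_j}-N(M-N)}\sum_{\overline{\mathcal T}}\Big(\prod_{i=0}^{N-1}\prod_{j=i}^{N-1}\overline{\gamma}(\overline{a_{i,j}})\Big) z_N^{d_0(\overline{\mathcal T})-d_1(\overline{\mathcal T})}z_{N-1}^{d_1(\overline{\mathcal T})-d_2(\overline{\mathcal T})}\cdots z_2^{d_{N-2}(\overline{\mathcal T})-d_{N-1}(\overline{\mathcal T})}z_1^{d_{N-1}(\overline{\mathcal T})},$$ where the sum is over all strict (dual) Gelfand-Tsetlin patterns $\overline{\mathcal T}=(\overline{a_{i,j}})_{0\le i\le j\le N-1}$ whose bottom row is $\overline{a_{0,j}}=\overline{\lambda_{j+1}}+N-j-1$, $j=0,\dots,N-1$.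
   Context: The Schur polynomial for $\lambda=(\lambda_1\ge\cdots\ge\lambda_N\ge0)$ is $s_\lambda(z_1,\dots,z_N)=\det_{1\le j,k\le N}(z_j^{\lambda_k+N-k})/\prod_{1\le j<k\le N}(z_j-z_k)$. A strict (dual) Gelfand-Tsetlin pattern is an array of integers $\overline{\mathcal T}=(\overline{a_{i,j}})_{0\le i\le j\le N-1}$ whose $i$-th row (counted from the bottom, starting from $i=0$) is $\overline{a_{i,i}},\dots,\overline{a_{i,N-1}}$, such that the rows interlace, $\overline{a_{i-1,j-1}}\ge\overline{a_{i,j}}\ge\overline{a_{i-1,j}}$ for $1\le i\le j\le N-1$, and each row is strictly decreasing: $\overline{a_{i,i}}>\overline{a_{i,i+1}}>\cdots>\overline{a_{i,N-1}}$. One also sets $\overline{a_{j,j-1}}=M$ for $j=1,\dots,N$. Put $d_j(\overline{\mathcal T})=\sum_{k=j}^{N-1}\overline{a_{j,k}}$, $j=0,\dots,N-1$. For $0\le i\le j\le N-1$, $$\overline{\gamma}(\overline{a_{i,j}})=t^{\max(\overline{a_{i+1,j}}-\overline{a_{i,j}}-1,\,0)}\times c_{i,j},$$ where $c_{i,j}=t+1$ if $i\ge1$ and $\overline{a_{i-1,j}}\ne\overline{a_{i,j}}\ne\overline{a_{i-1,j-1}}$, and $c_{i,j}=1$ otherwise (in particular $c_{0,j}=1$). *)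

theory Defs
  imports
    "HOL-Library.Poly_Mapping"
    "HOL-Library.FuncSet"
    "HOL-Computational_Algebra.Polynomial_Factorial"
    "Jordan_Normal_Form.Determinant"
begin

text \<open>
  Polynomials in the indeterminates \<open>x\<^sub>0, x\<^sub>1, \<dots>\<close> over \<open>'a\<close> are finitely supported functions from
  exponent vectors to coefficients. Their field of fractions is where quotients of polynomials live.
\<close>

type_synonym 'a mpoly = "(nat \<Rightarrow>\<^sub>0 nat) \<Rightarrow>\<^sub>0 'a"

definition indet :: "nat \<Rightarrow> 'a::field mpoly fract" where
  "indet i = to_fract (Poly_Mapping.single (Poly_Mapping.single i 1) 1)"

definition const_fract :: "'a \<Rightarrow> 'a::field mpoly fract" where
  "const_fract c = to_fract (Poly_Mapping.single 0 c)"

definition is_young :: "nat \<Rightarrow> (nat \<Rightarrow> nat) \<Rightarrow> bool" where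
  "is_young N lam \<longleftrightarrow> (\<forall>j k. 1 \<le> j \<and> j \<le> k \<and> k \<le> N \<longrightarrow> lam k \<le> lam j)"

text \<open>
  Parts and variables are numbered from 1, but matrix indices start at 0. The quotient is meaningful
  when \<open>z 1, \<dots>, z N\<close> are pairwise distinct, in particular when they are indeterminates.
\<close>

definition schur :: "nat \<Rightarrow> (nat \<Rightarrow> nat) \<Rightarrow> (nat \<Rightarrow> 'b::field) \<Rightarrow> 'b" where
  "schur N lam z =
     det (mat N N (\<lambda>(j, k). z (j + 1) ^ (lam (k + 1) + N - (k + 1))))
       / (\<Prod>(j, k) \<in> {(j, k). 1 \<le> j \<and> j < k \<and> k \<le> N}. z j - z k)"

definition gt_index :: "nat \<Rightarrow> (nat \<times> nat) set" where
  "gt_index N = {(i, j). i \<le> j \<and> j < N}"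

text \<open>
  Patterns are extensional on \<open>gt_index N\<close>, so that each array is represented by exactly one function.
\<close>

definition strict_dual_GT :: "nat \<Rightarrow> (nat \<times> nat \<Rightarrow> int) set" where
  "strict_dual_GT N = {a \<in> gt_index N \<rightarrow>\<^sub>E UNIV.
     (\<forall>i j. 1 \<le> i \<and> i \<le> j \<and> j < N \<longrightarrow> a (i - 1, j - 1) \<ge> a (i, j) \<and> a (i, j) \<ge> a (i - 1, j)) \<and>
     (\<forall>i j. i \<le> j \<and> j + 1 < N \<longrightarrow> a (i, j) > a (i, j + 1))}"

definition strict_dual_GT_bottom :: "nat \<Rightarrow> (nat \<Rightarrow> nat) \<Rightarrow> (nat \<times> nat \<Rightarrow> int) set" where
  "strict_dual_GT_bottom N lam =
     {a \<in> strict_dual_GT N. \<forall>j<N. a (0, j) = int (lam (j + 1)) + int N - int j - 1}"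

text \<open>The convention that the entry at position \<open>(j, j - 1)\<close> is \<open>M\<close> for \<open>j = 1, \<dots>, N\<close>.\<close>

definition gt_entry :: "nat \<Rightarrow> (nat \<times> nat \<Rightarrow> int) \<Rightarrow> nat \<Rightarrow> nat \<Rightarrow> int" where
  "gt_entry M a i j = (if i = j + 1 then int M else a (i, j))"

definition row_sum :: "nat \<Rightarrow> (nat \<times> nat \<Rightarrow> int) \<Rightarrow> nat \<Rightarrow> int" where
  "row_sum N a j = (\<Sum>k = j..<N. a (j, k))"

definition gt_factor :: "'b::field \<Rightarrow> (nat \<times> nat \<Rightarrow> int) \<Rightarrow> nat \<Rightarrow> nat \<Rightarrow> 'b" where
  "gt_factor t a i j =
     (if i \<ge> 1 \<and> a (i - 1, j) \<noteq> a (i, j) \<and> a (i, j) \<noteq> a (i - 1, j - 1) then t + 1 else 1)"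

definition gt_gamma :: "nat \<Rightarrow> 'b::field \<Rightarrow> (nat \<times> nat \<Rightarrow> int) \<Rightarrow> nat \<Rightarrow> nat \<Rightarrow> 'b" where
  "gt_gamma M t a i j =
     t powi (max (gt_entry M a (i + 1) j - gt_entry M a i j - 1) 0) * gt_factor t a i j"

end

theory Submission
  imports Defs
begin

text \<open>
  Induction on the number of variables. Write \<open>A\<^sub>\<mu>\<close> for the alternant \<open>det (z\<^sub>j ^ \<mu>\<^sub>k)\<close> and \<open>y\<close> for the
  last variable. Removing the bottom row \<open>\<mu>\<close> of a pattern leaves a pattern whose bottom row \<open>\<nu>\<close>
  interlaces \<open>\<mu>\<close>, so the theorem reduces to
  \<open>\<Prod> (z\<^sub>j - y) * (\<Sum>\<nu>. w(\<mu>, \<nu>) y ^ (|\<mu>| - |\<nu>|) A\<^sub>\<nu>) = \<Prod> (z\<^sub>j + t y) * A\<^sub>\<mu>\<close>.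
  Rows \<open>\<nu>\<close> that are not strict may be included because their alternant vanishes. The entries of \<open>\<nu>\<close>
  then range independently over intervals, and by multilinearity the sum is a single determinant,
  whose entries are evaluated as geometric series to
  \<open>(z\<^sub>j + t y) / (z\<^sub>j - y) * (z\<^sub>j ^ \<mu>\<^sub>k - y ^ (\<mu>\<^sub>k - \<mu>\<^sub>k\<^sub>+\<^sub>1) z\<^sub>j ^ \<mu>\<^sub>k\<^sub>+\<^sub>1)\<close>.
  These differences are what column operations produce from \<open>A\<^sub>\<mu>\<close> when its last row is cleared.
\<close>

section \<open>Determinant identities\<close>

text \<open>Each column is a combination of columns \<open>f _ m\<close>. The Leibniz formula picks
  one summand per column independently, so the choices \<open>g\<close> form a product set. With
  intervals for \<open>S\<close> this is the set of interlacing rows.\<close>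

lemma det_sum_columns:
  fixes f :: "nat \<Rightarrow> 'c \<Rightarrow> 'b::comm_ring_1"
  assumes "\<And>k. k < n \<Longrightarrow> finite (S k)"
  shows "det (mat n n (\<lambda>(j, k). \<Sum>m\<in>S k. c k m * f j m)) =
    (\<Sum>g\<in>Pi\<^sub>E {..<n} S. (\<Prod>k<n. c k (g k)) * det (mat n n (\<lambda>(j, k). f j (g k))))"
proof -
  let ?P = "{p. p permutes {0..<n}}"
  have lt: "p k < n" if "p \<in> ?P" "k < n" for p k
    using that permutes_in_image[of p "{0..<n}" k] by simp
  have "det (mat n n (\<lambda>(j, k). \<Sum>m\<in>S k. c k m * f j m)) =
      (\<Sum>p\<in>?P. signof p * (\<Prod>k<n. \<Sum>m\<in>S k. c k m * f (p k) m))"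
    by (subst det_col[of _ n]) (auto intro!: sum.cong prod.cong simp: lt)
  also have "\<dots> = (\<Sum>p\<in>?P. \<Sum>g\<in>Pi\<^sub>E {..<n} S.
      (\<Prod>k<n. c k (g k)) * (signof p * (\<Prod>k<n. f (p k) (g k))))"
    using assms
    by (subst prod_sum_PiE) (auto simp: sum_distrib_left prod.distrib mult_ac intro!: sum.cong)
  also have "\<dots> = (\<Sum>g\<in>Pi\<^sub>E {..<n} S. (\<Prod>k<n. c k (g k)) *
      (\<Sum>p\<in>?P. signof p * (\<Prod>k<n. f (p k) (g k))))"
    by (subst sum.swap) (simp add: sum_distrib_left)
  also have "\<dots> = (\<Sum>g\<in>Pi\<^sub>E {..<n} S. (\<Prod>k<n. c k (g k)) * det (mat n n (\<lambda>(j, k). f j (g k))))"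
    by (subst det_col[of _ n]) (auto intro!: sum.cong prod.cong arg_cong2[where f="(*)"] simp: lt)
  finally show ?thesis .
qed

lemma det_scale_rows:
  fixes f :: "nat \<Rightarrow> nat \<Rightarrow> 'b::comm_ring_1"
  shows "det (mat n n (\<lambda>(j, k). c j * f j k)) = (\<Prod>j<n. c j) * det (mat n n (\<lambda>(j, k). f j k))"
proof -
  let ?P = "{p. p permutes {0..<n}}"
  have lt: "p k < n" if "p permutes {0..<n}" "k < n" for p k
    using that permutes_in_image[of p "{0..<n}" k] by simp
  have "det (mat n n (\<lambda>(j, k). c j * f j k)) =
      (\<Sum>p\<in>?P. signof p * (\<Prod>j = 0..<n. c j * f j (p j)))"
    by (subst det_def'[of _ n]) (auto intro!: sum.cong prod.cong simp: lt)
  also have "\<dots> = (\<Prod>j<n. c j) * (\<Sum>p\<in>?P. signof p * (\<Prod>j = 0..<n. f j (p j)))"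
    by (simp add: prod.distrib sum_distrib_left mult_ac atLeast0LessThan)
  also have "(\<Sum>p\<in>?P. signof p * (\<Prod>j = 0..<n. f j (p j))) = det (mat n n (\<lambda>(j, k). f j k))"
    by (subst det_def'[of _ n]) (auto intro!: sum.cong prod.cong arg_cong2[where f="(*)"] simp: lt)
  finally show ?thesis .
qed

text \<open>Subtracting \<open>c k\<close> times column \<open>Suc k\<close> from column
  \<open>k\<close> clears the last row except for its corner, and expansion along that row leaves
  the minor.\<close>

lemma det_clear_last_row:
  fixes f :: "nat \<Rightarrow> nat \<Rightarrow> 'b::comm_ring_1"
  assumes "\<And>k. k < n \<Longrightarrow> f n k = c k * f n (Suc k)"
  shows "det (mat (Suc n) (Suc n) (\<lambda>(j, k). f j k)) =
    f n n * det (mat n n (\<lambda>(j, k). f j k - c k * f j (Suc k)))"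
proof -
  define A where "A = mat (Suc n) (Suc n) (\<lambda>(j, k). f j k)"
  \<comment> \<open>Right multiplication by this unipotent bidiagonal matrix performs all the column
    operations at once, each using the original column \<open>Suc k\<close>. For
    \<open>k = n\<close> the index \<open>Suc k\<close> is out of range, so the last column is
    unchanged.\<close>
  define U where "U = mat (Suc n) (Suc n) (\<lambda>(j, k). if j = k then 1 else if j = Suc k then - c k else 0)"
  define B where "B = mat (Suc n) (Suc n) (\<lambda>(j, k). if k < n then f j k - c k * f j (Suc k) else f j k)"
  have carr: "A \<in> carrier_mat (Suc n) (Suc n)" "U \<in> carrier_mat (Suc n) (Suc n)"
    "B \<in> carrier_mat (Suc n) (Suc n)"
    by (auto simp: A_def U_def B_def)
  have "A * U = B"
  proof (rule eq_matI)
    fix i k assume ik: "i < dim_row B" "k < dim_col B"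
    have "(A * U) $$ (i, k) =
        (\<Sum>l = 0..<Suc n. (if l = k then f i k else 0) + (if l = Suc k then - c k * f i (Suc k) else 0))"
      using ik by (auto simp: A_def U_def B_def scalar_prod_def simp del: sum.op_ivl_Suc intro!: sum.cong)
    also have "\<dots> = B $$ (i, k)"
      using ik by (subst sum.distrib) (auto simp: B_def simp del: sum.op_ivl_Suc)
    finally show "(A * U) $$ (i, k) = B $$ (i, k)" .
  qed (auto simp: A_def U_def B_def)
  moreover have "det U = 1"
    by (subst det_lower_triangular[OF _ carr(2)]) (auto simp: U_def prod_list_diag_prod)
  ultimately have "det A = det B"
    using det_mult[OF carr(1,2)] by simp
  also have "det B = (\<Sum>k<Suc n. B $$ (n, k) * cofactor B n k)"
    by (rule laplace_expansion_row[OF carr(3)]) simp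
  also have "\<dots> = B $$ (n, n) * cofactor B n n"
    using assms by (simp add: B_def)
  also have "mat_delete B n n = mat n n (\<lambda>(j, k). f j k - c k * f j (Suc k))"
    by (rule eq_matI) (auto simp: mat_delete_def B_def)
  hence "cofactor B n n = det (mat n n (\<lambda>(j, k). f j k - c k * f j (Suc k)))"
    by (simp add: cofactor_def)
  finally show ?thesis by (simp add: A_def B_def)
qed

section \<open>Weighted geometric sums\<close>

text \<open>
  The weight of an entry \<open>m\<close> lying between \<open>b < a\<close> once the power \<open>t ^ (m - b - 1)\<close> is split off from
  its factors in \<open>gt_gamma\<close>. The truncation of the exponent at 0 matters only for \<open>m = b\<close> and
  accounts for the weight \<open>t\<close> in that case.
\<close>

definition edge_weight :: "'b::field \<Rightarrow> int \<Rightarrow> int \<Rightarrow> int \<Rightarrow> 'b" where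
  "edge_weight t a b m = (if m = b then t else if m = a then 1 else t + 1)"

lemma sum_powi_geometric:
  fixes x y :: "'b::field"
  assumes "b \<le> a" "x \<noteq> 0" "y \<noteq> 0"
  shows "(x - y) * (\<Sum>m = b..<a. x powi m * y powi (a - 1 - m)) = x powi a - x powi b * y powi (a - b)"
  using assms(1)
proof (induction a rule: int_ge_induct)
  case (step a)
  have eq: "{b..<a + 1} = insert a {b..<a}" using step by auto
  \<comment> \<open>Raising the upper end multiplies every old summand by \<open>y\<close> and adds
    the single new term \<open>x powi a\<close>.\<close>
  have "(\<Sum>m = b..<a. x powi m * y powi (a + 1 - 1 - m)) = y * (\<Sum>m = b..<a. x powi m * y powi (a - 1 - m))"
    using assms by (auto simp: sum_distrib_left power_int_diff power_int_add field_simps intro!: sum.cong)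
  hence "(x - y) * (\<Sum>m = b..<a + 1. x powi m * y powi (a + 1 - 1 - m)) =
      (x - y) * x powi a + y * ((x - y) * (\<Sum>m = b..<a. x powi m * y powi (a - 1 - m)))"
    unfolding eq by (simp add: algebra_simps)
  thus ?case unfolding step.IH using assms
    by (simp add: power_int_diff power_int_add field_simps)
qed simp

text \<open>Each \<open>m > b\<close> receives weight 1 and each \<open>m < a\<close> receives
  weight \<open>t\<close>; interior points receive both, hence \<open>t + 1\<close>. The two
  half-open sums are \<open>x\<close> and \<open>t * y\<close> times one geometric sum.\<close>

lemma sum_edge_weight:
  fixes x y :: "'b::field"
  assumes "b < a" "x \<noteq> 0" "y \<noteq> 0"
  shows "(x - y) * (\<Sum>m = b..a. edge_weight t a b m * y powi (a - m) * x powi m) =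
    (x + t * y) * (x powi a - y powi (a - b) * x powi b)"
proof -
  let ?g = "\<lambda>m. x powi m * y powi (a - m)" and ?h = "\<Sum>m = b..<a. x powi m * y powi (a - 1 - m)"
  have "(\<Sum>m = b..a. edge_weight t a b m * y powi (a - m) * x powi m) =
      (\<Sum>m = b..a. (if m \<in> {b<..a} then ?g m else 0) + (if m \<in> {b..<a} then t * ?g m else 0))"
    using assms by (intro sum.cong) (auto simp: edge_weight_def algebra_simps)
  also have "\<dots> = (\<Sum>m\<in>{b<..a}. ?g m) + t * (\<Sum>m = b..<a. ?g m)"
    unfolding sum.distrib sum_distrib_left
    by (intro arg_cong2[where f="(+)"] sum.mono_neutral_cong_right) auto
  also have "(\<Sum>m = b..<a. ?g m) = y * ?h"
    using assms by (auto simp: sum_distrib_left power_int_diff power_int_add field_simps intro!: sum.cong)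
  also have "(\<Sum>m\<in>{b<..a}. ?g m) = (\<Sum>m = b..<a. ?g (m + 1))"
    by (rule sum.reindex_bij_witness[of _ "\<lambda>m. m + 1" "\<lambda>m. m - 1"]) auto
  also have "\<dots> = x * ?h"
    using assms by (auto simp: sum_distrib_left power_int_add power_int_diff field_simps intro!: sum.cong)
  finally have "(\<Sum>m = b..a. edge_weight t a b m * y powi (a - m) * x powi m) = (x + t * y) * ?h"
    by (simp add: algebra_simps)
  thus ?thesis
    using sum_powi_geometric[of b a x y] assms by (simp add: mult.left_commute mult.commute)
qed

section \<open>Branching of alternants\<close>

text \<open>The numerator of a Schur quotient. Exponents are integers because the rows of patterns
  are.\<close>

definition alternant :: "nat \<Rightarrow> (nat \<Rightarrow> 'b::field) \<Rightarrow> (nat \<Rightarrow> int) \<Rightarrow> 'b" where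
  "alternant n z \<mu> = det (mat n n (\<lambda>(j, k). z (Suc j) powi \<mu> k))"

abbreviation interlacing :: "nat \<Rightarrow> (nat \<Rightarrow> int) \<Rightarrow> (nat \<Rightarrow> int) set" where
  "interlacing n \<mu> \<equiv> Pi\<^sub>E {..<n} (\<lambda>k. {\<mu> (Suc k)..\<mu> k})"

lemma alternant_branching:
  fixes z :: "nat \<Rightarrow> 'b::field"
  assumes nz: "\<And>i. z i \<noteq> 0" and strict: "\<And>k. k < n \<Longrightarrow> \<mu> (Suc k) < \<mu> k"
  shows "(\<Prod>j<n. z (Suc j) - z (Suc n)) *
      (\<Sum>\<nu>\<in>interlacing n \<mu>. (\<Prod>k<n. edge_weight t (\<mu> k) (\<mu> (Suc k)) (\<nu> k)) *
         z (Suc n) powi ((\<Sum>k<Suc n. \<mu> k) - (\<Sum>k<n. \<nu> k)) * alternant n z \<nu>) =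
    (\<Prod>j<n. z (Suc j) + t * z (Suc n)) * alternant (Suc n) z \<mu>"
proof -
  define y where "y = z (Suc n)"
  define x where "x = (\<lambda>j. z (Suc j))"
  have xy: "y \<noteq> 0" "\<And>j. x j \<noteq> 0" using nz by (auto simp: x_def y_def)
  \<comment> \<open>The power of \<open>y\<close> is spread over the columns:
    \<open>y powi (\<mu> k - \<nu> k)\<close> joins the weight of column \<open>k\<close>, and only
    \<open>y powi \<mu> n\<close> stays outside.\<close>
  have pw: "y powi ((\<Sum>k<Suc n. \<mu> k) - (\<Sum>k<n. \<nu> k)) = y powi \<mu> n * (\<Prod>k<n. y powi (\<mu> k - \<nu> k))" for \<nu>
    using xy(1) by (induction n) (simp_all add: power_int_diff power_int_add field_simps)
  let ?G = "\<lambda>j k. \<Sum>m = \<mu> (Suc k)..\<mu> k. edge_weight t (\<mu> k) (\<mu> (Suc k)) m * y powi (\<mu> k - m) * x j powi m"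
  let ?D = "\<lambda>j k. x j powi \<mu> k - y powi (\<mu> k - \<mu> (Suc k)) * x j powi \<mu> (Suc k)"
  have "(\<Sum>\<nu>\<in>interlacing n \<mu>. (\<Prod>k<n. edge_weight t (\<mu> k) (\<mu> (Suc k)) (\<nu> k)) *
         y powi ((\<Sum>k<Suc n. \<mu> k) - (\<Sum>k<n. \<nu> k)) * alternant n z \<nu>) =
      y powi \<mu> n * det (mat n n (\<lambda>(j, k). ?G j k))"
    by (subst det_sum_columns)
       (simp_all add: pw alternant_def x_def prod.distrib sum_distrib_left mult_ac del: sum.lessThan_Suc)
  \<comment> \<open>The factor \<open>x j - y\<close> is absorbed into row \<open>j\<close>, where
    it sums the geometric series without any division.\<close>
  hence "(\<Prod>j<n. x j - y) * (\<Sum>\<nu>\<in>interlacing n \<mu>. (\<Prod>k<n. edge_weight t (\<mu> k) (\<mu> (Suc k)) (\<nu> k)) *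
         y powi ((\<Sum>k<Suc n. \<mu> k) - (\<Sum>k<n. \<nu> k)) * alternant n z \<nu>) =
      y powi \<mu> n * det (mat n n (\<lambda>(j, k). (x j - y) * ?G j k))"
    by (simp add: det_scale_rows)
  also have "mat n n (\<lambda>(j, k). (x j - y) * ?G j k) = mat n n (\<lambda>(j, k). (x j + t * y) * ?D j k)"
    using strict xy by (intro cong_mat) (auto simp: sum_edge_weight)
  also have "y powi \<mu> n * det \<dots> = (\<Prod>j<n. x j + t * y) * (x n powi \<mu> n * det (mat n n (\<lambda>(j, k). ?D j k)))"
    by (simp add: det_scale_rows x_def y_def)
  \<comment> \<open>Since \<open>x n = y\<close>, the last row of the alternant consists of powers
    of \<open>y\<close>, and \<open>c k = y powi (\<mu> k - \<mu> (Suc k))\<close> relates its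
    neighbouring entries. The leftover prefactor is the corner entry.\<close>
  also have "x n powi \<mu> n * det (mat n n (\<lambda>(j, k). ?D j k)) =
      det (mat (Suc n) (Suc n) (\<lambda>(j, k). x j powi \<mu> k))"
    by (rule det_clear_last_row[symmetric])
       (use xy in \<open>simp add: x_def y_def flip: power_int_add\<close>)
  finally show ?thesis by (simp add: alternant_def x_def y_def)
qed

lemma alternant_eq_0:
  assumes "k < l" "l < n" "\<mu> k = \<mu> l"
  shows "alternant n z \<mu> = 0"
  unfolding alternant_def
  by (rule det_identical_columns[of _ n k l]) (use assms in \<open>auto intro!: eq_vecI\<close>)


section \<open>Removing and attaching the bottom row of a pattern\<close>

text \<open>An arbitrary integer row is allowed, since the rows met in the induction are not given
  by a Young diagram.\<close>

definition GT_with_row :: "nat \<Rightarrow> (nat \<Rightarrow> int) \<Rightarrow> (nat \<times> nat \<Rightarrow> int) set" where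
  "GT_with_row n \<mu> = {a \<in> strict_dual_GT n. \<forall>j<n. a (0, j) = \<mu> j}"

text \<open>Row \<open>i\<close> starts at column \<open>i\<close>, so placing a new row below
  shifts both indices by one.\<close>

definition attach_row :: "nat \<Rightarrow> (nat \<Rightarrow> int) \<Rightarrow> (nat \<times> nat \<Rightarrow> int) \<Rightarrow> nat \<times> nat \<Rightarrow> int" where
  "attach_row n \<mu> b = restrict (\<lambda>(i, j). if i = 0 then \<mu> j else b (i - 1, j - 1)) (gt_index (Suc n))"

lemma attach_row_simps [simp]:
  "j \<le> n \<Longrightarrow> attach_row n \<mu> b (0, j) = \<mu> j"
  "i \<le> j \<Longrightarrow> j < n \<Longrightarrow> attach_row n \<mu> b (Suc i, Suc j) = b (i, j)"
  by (auto simp: attach_row_def gt_index_def)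

lemma inj_on_attach_row: "inj_on (attach_row n \<mu>) (gt_index n \<rightarrow>\<^sub>E UNIV)"
proof (rule inj_onI)
  fix b b' :: "nat \<times> nat \<Rightarrow> int"
  assume b: "b \<in> gt_index n \<rightarrow>\<^sub>E UNIV" and b': "b' \<in> gt_index n \<rightarrow>\<^sub>E UNIV"
    and eq: "attach_row n \<mu> b = attach_row n \<mu> b'"
  show "b = b'"
  proof (rule PiE_ext[OF b b'])
    fix p assume "p \<in> gt_index n"
    then obtain i j where "p = (i, j)" "i \<le> j" "j < n" by (auto simp: gt_index_def)
    with fun_cong[OF eq, of "(Suc i, Suc j)"] show "b p = b' p" by simp
  qed
qed

text \<open>The only new conditions are strictness of row 0, which is assumed, and interlacing of
  rows 0 and 1, which is the choice of \<open>\<nu>\<close>; all others come from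
  \<open>b\<close>.\<close>

lemma attach_row_in_GT:
  assumes strict: "\<And>k. k < n \<Longrightarrow> \<mu> (Suc k) < \<mu> k"
    and \<nu>: "\<nu> \<in> interlacing n \<mu>" and b: "b \<in> GT_with_row n \<nu>"
  shows "attach_row n \<mu> b \<in> GT_with_row (Suc n) \<mu>"
proof -
  let ?a = "attach_row n \<mu> b"
  have row: "b (0, j) = \<nu> j" "\<mu> (Suc j) \<le> \<nu> j" "\<nu> j \<le> \<mu> j" if "j < n" for j
    using b \<nu> that by (auto simp: GT_with_row_def PiE_iff)
  have b_inter: "b (i - 1, j - 1) \<ge> b (i, j) \<and> b (i, j) \<ge> b (i - 1, j)"
    if "1 \<le> i" "i \<le> j" "j < n" for i j
    using b that unfolding GT_with_row_def strict_dual_GT_def by blast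
  have "?a (i - 1, j - 1) \<ge> ?a (i, j) \<and> ?a (i, j) \<ge> ?a (i - 1, j)" if ij1: "1 \<le> i" "i \<le> j" "j < Suc n" for i j
  proof -
    obtain i' j' where ij: "i = Suc i'" "j = Suc j'" using \<open>1 \<le> i\<close> \<open>i \<le> j\<close> by (cases i; cases j) auto
    show ?thesis
    proof (cases i')
      case 0
      thus ?thesis using ij that row[of j'] by simp
    next
      case (Suc i'')
      moreover then obtain j'' where "j' = Suc j''" using ij1 ij by (cases j') auto
      moreover have "b (i' - 1, j' - 1) \<ge> b (i', j') \<and> b (i', j') \<ge> b (i' - 1, j')"
        using b_inter[of i' j'] ij ij1 Suc by auto
      ultimately show ?thesis using ij ij1 by simp
    qed
  qed
  moreover have "?a (i, j) > ?a (i, j + 1)" if ij: "i \<le> j" "j + 1 < Suc n" for i j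
  proof (cases i)
    case 0
    thus ?thesis using strict that by simp
  next
    case (Suc i')
    moreover then obtain j' where "j = Suc j'" using ij by (cases j) auto
    ultimately show ?thesis using ij b by (simp add: GT_with_row_def strict_dual_GT_def)
  qed
  moreover have "?a \<in> gt_index (Suc n) \<rightarrow>\<^sub>E UNIV" by (auto simp: attach_row_def)
  ultimately show ?thesis by (auto simp: GT_with_row_def strict_dual_GT_def)
qed

lemma GT_with_row_Suc:
  assumes strict: "\<And>k. k < n \<Longrightarrow> \<mu> (Suc k) < \<mu> k"
  shows "GT_with_row (Suc n) \<mu> = attach_row n \<mu> ` (\<Union>\<nu>\<in>interlacing n \<mu>. GT_with_row n \<nu>)"
proof (intro equalityI subsetI)
  fix a assume a: "a \<in> GT_with_row (Suc n) \<mu>"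
  hence "a (i - 1, j - 1) \<ge> a (i, j) \<and> a (i, j) \<ge> a (i - 1, j)"
    if "1 \<le> i" "i \<le> j" "j < Suc n" for i j
    using that unfolding GT_with_row_def strict_dual_GT_def by blast
  \<comment> \<open>Instantiating with successors removes the truncated subtractions.\<close>
  from this[of "Suc _" "Suc _"]
  have inter: "a (i, j) \<ge> a (Suc i, Suc j)" "a (Suc i, Suc j) \<ge> a (i, Suc j)" if "i \<le> j" "j < n" for i j
    using that by simp_all
  have dec: "a (i, j) > a (i, j + 1)" if "i \<le> j" "j < n" for i j
    using a that by (auto simp: GT_with_row_def strict_dual_GT_def)
  have row: "a (0, j) = \<mu> j" if "j < Suc n" for j
    using a that by (auto simp: GT_with_row_def)
  define b where "b = restrict (\<lambda>(i, j). a (Suc i, Suc j)) (gt_index n)"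
  \<comment> \<open>The row above the bottom row, reindexed from 0; the restriction places it in the
    extensional set \<open>interlacing n \<mu>\<close>.\<close>
  define \<nu> where "\<nu> = restrict (\<lambda>k. a (1, Suc k)) {..<n}"
  have b_simp: "b (i, j) = a (Suc i, Suc j)" if "i \<le> j" "j < n" for i j
    using that by (simp add: b_def gt_index_def)
  have "\<nu> \<in> interlacing n \<mu>"
    using inter[of 0] row by (auto simp: \<nu>_def)
  moreover have "b \<in> GT_with_row n \<nu>"
  proof -
    have "b (i - 1, j - 1) \<ge> b (i, j) \<and> b (i, j) \<ge> b (i - 1, j)" if "1 \<le> i" "i \<le> j" "j < n" for i j
    proof -
      obtain i' j' where "i = Suc i'" "j = Suc j'" using \<open>1 \<le> i\<close> \<open>i \<le> j\<close> by (cases i; cases j) auto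
      thus ?thesis using that inter[of i j] by (simp add: b_simp)
    qed
    thus ?thesis using dec
      by (auto simp: GT_with_row_def strict_dual_GT_def b_simp \<nu>_def) (auto simp: b_def)
  qed
  moreover have "a = attach_row n \<mu> b"
  proof (rule PiE_ext[of _ "gt_index (Suc n)"])
    fix p assume "p \<in> gt_index (Suc n)"
    then obtain i j where p: "p = (i, j)" "i \<le> j" "j < Suc n" by (auto simp: gt_index_def)
    show "a p = attach_row n \<mu> b p"
    proof (cases i)
      case 0
      thus ?thesis using p row by simp
    next
      case (Suc i')
      moreover then obtain j' where "j = Suc j'" using p by (cases j) auto
      ultimately show ?thesis using p by (simp add: b_simp)
    qed
  next
    show "a \<in> gt_index (Suc n) \<rightarrow>\<^sub>E UNIV" using a by (simp add: GT_with_row_def strict_dual_GT_def)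
    show "attach_row n \<mu> b \<in> gt_index (Suc n) \<rightarrow>\<^sub>E UNIV" by (auto simp: attach_row_def)
  qed
  ultimately show "a \<in> attach_row n \<mu> ` (\<Union>\<nu>\<in>interlacing n \<mu>. GT_with_row n \<nu>)" by blast
qed (use attach_row_in_GT[of n \<mu>, OF strict] in blast)

lemma GT_with_row_not_strict:
  assumes "Suc k < n" "\<not> \<mu> (Suc k) < \<mu> k"
  shows "GT_with_row n \<mu> = {}"
proof -
  have "a \<notin> GT_with_row n \<mu>" for a
  proof
    assume a: "a \<in> GT_with_row n \<mu>"
    hence dec: "\<forall>i j. i \<le> j \<and> j + 1 < n \<longrightarrow> a (i, j) > a (i, j + 1)" and row: "\<forall>j<n. a (0, j) = \<mu> j"
      unfolding GT_with_row_def strict_dual_GT_def by simp_all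
    have "a (0, k) > a (0, Suc k)" using dec assms(1) by simp
    thus False using row assms by simp
  qed
  thus ?thesis by blast
qed

text \<open>Over an empty index set there is exactly one extensional function, so the empty pattern
  counts once.\<close>

lemma GT_with_row_0: "GT_with_row 0 \<mu> = {\<lambda>_. undefined}"
  by (auto simp: GT_with_row_def strict_dual_GT_def gt_index_def)

lemma finite_interlacing: "finite (interlacing n \<mu>)"
  by (intro finite_PiE) auto

lemma finite_GT_with_row: "finite (GT_with_row n \<mu>)"
proof (induction n arbitrary: \<mu>)
  case (Suc n)
  show ?case
  proof (cases "\<forall>k<n. \<mu> (Suc k) < \<mu> k")
    case True
    thus ?thesis using Suc by (subst GT_with_row_Suc) (auto simp: finite_interlacing)
  next
    case False
    then obtain k where "k < n" "\<not> \<mu> (Suc k) < \<mu> k" by blast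
    thus ?thesis by (simp add: GT_with_row_not_strict[of k])
  qed
qed (simp add: GT_with_row_0)

lemma sum_GT_with_row_Suc:
  assumes strict: "\<And>k. k < n \<Longrightarrow> \<mu> (Suc k) < \<mu> k"
  shows "(\<Sum>a\<in>GT_with_row (Suc n) \<mu>. f a) =
    (\<Sum>\<nu>\<in>interlacing n \<mu>. \<Sum>b\<in>GT_with_row n \<nu>. f (attach_row n \<mu> b))"
proof -
  have "inj_on (attach_row n \<mu>) (\<Union>\<nu>\<in>interlacing n \<mu>. GT_with_row n \<nu>)"
    by (rule inj_on_subset[OF inj_on_attach_row]) (auto simp: GT_with_row_def strict_dual_GT_def)
  \<comment> \<open>Distinct extensional rows differ at some \<open>k < n\<close>, and a pattern
    determines its bottom row.\<close>
  moreover have "GT_with_row n \<nu> \<inter> GT_with_row n \<nu>' = {}"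
    if \<nu>: "\<nu> \<in> interlacing n \<mu>" "\<nu>' \<in> interlacing n \<mu>" "\<nu> \<noteq> \<nu>'" for \<nu> \<nu>'
  proof -
    obtain k where "k < n" "\<nu> k \<noteq> \<nu>' k"
      using PiE_ext[OF \<nu>(1,2)] \<nu>(3) by auto
    thus ?thesis by (auto simp: GT_with_row_def)
  qed
  ultimately show ?thesis
    by (simp add: GT_with_row_Suc[of n \<mu>, OF strict] sum.reindex sum.UNION_disjoint
        finite_interlacing finite_GT_with_row)
qed

section \<open>Weights and monomials of patterns\<close>

lemma prod_powi:
  fixes x :: "'b::field"
  assumes "x \<noteq> 0"
  shows "(\<Prod>i\<in>A. x powi f i) = x powi (\<Sum>i\<in>A. f i)"
  using assms by (induction A rule: infinite_finite_induct) (simp_all add: power_int_add)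

definition pattern_weight :: "nat \<Rightarrow> 'b::field \<Rightarrow> nat \<Rightarrow> (nat \<times> nat \<Rightarrow> int) \<Rightarrow> 'b" where
  "pattern_weight M t n a = (\<Prod>i = 0..<n. \<Prod>j = i..<n. gt_gamma M t a i j)"

text \<open>As \<open>row_sum n a n\<close> is an empty sum, the factor for \<open>i = n - 1\<close>
  is the power of \<open>z 1\<close> that otherwise needs separate treatment.\<close>

definition pattern_monom :: "(nat \<Rightarrow> 'b::field) \<Rightarrow> nat \<Rightarrow> (nat \<times> nat \<Rightarrow> int) \<Rightarrow> 'b" where
  "pattern_monom z n a = (\<Prod>i = 0..<n. z (n - i) powi (row_sum n a i - row_sum n a (Suc i)))"

definition pattern_sum :: "nat \<Rightarrow> 'b::field \<Rightarrow> (nat \<Rightarrow> 'b) \<Rightarrow> nat \<Rightarrow> (nat \<Rightarrow> int) \<Rightarrow> 'b" where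
  "pattern_sum M t z n \<mu> = (\<Sum>a\<in>GT_with_row n \<mu>. pattern_weight M t n a * pattern_monom z n a)"

lemma row_sum_attach_row:
  "row_sum (Suc n) (attach_row n \<mu> b) 0 = (\<Sum>k<Suc n. \<mu> k)"
  "row_sum (Suc n) (attach_row n \<mu> b) (Suc i) = row_sum n b i"
proof -
  show "row_sum (Suc n) (attach_row n \<mu> b) 0 = (\<Sum>k<Suc n. \<mu> k)"
    unfolding row_sum_def atLeast0LessThan by (rule sum.cong) auto
  show "row_sum (Suc n) (attach_row n \<mu> b) (Suc i) = row_sum n b i"
    unfolding row_sum_def sum.shift_bounds_Suc_ivl by (rule sum.cong) auto
qed

lemma pattern_monom_attach_row:
  assumes "b \<in> GT_with_row n \<nu>"
  shows "pattern_monom z (Suc n) (attach_row n \<mu> b) =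
    z (Suc n) powi ((\<Sum>k<Suc n. \<mu> k) - (\<Sum>k<n. \<nu> k)) * pattern_monom z n b"
proof -
  have "row_sum n b 0 = (\<Sum>k<n. \<nu> k)"
    using assms by (simp add: row_sum_def GT_with_row_def atLeast0LessThan)
  thus ?thesis
    by (simp add: pattern_monom_def prod.atLeast0_lessThan_Suc_shift row_sum_attach_row
        del: prod.op_ivl_Suc sum.lessThan_Suc)
qed

text \<open>Besides the weight of \<open>b\<close>, there appear the gammas of row 0 and the
  \<open>t + 1\<close> factors of row 1. The latter are absent from \<open>b\<close>, where that row
  is the bottom one.\<close>

lemma pattern_weight_attach_row:
  assumes t: "t \<noteq> 0" and strict: "\<And>k. k < n \<Longrightarrow> \<mu> (Suc k) < \<mu> k" and M: "\<mu> 0 < int M"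
    and \<nu>: "\<nu> \<in> interlacing n \<mu>" and b: "b \<in> GT_with_row n \<nu>"
  shows "pattern_weight M t (Suc n) (attach_row n \<mu> b) =
    t powi (int M - int n - 1 + (\<Sum>k<n. \<nu> k) - (\<Sum>k<Suc n. \<mu> k)) *
    (\<Prod>k<n. edge_weight t (\<mu> k) (\<mu> (Suc k)) (\<nu> k)) * pattern_weight M t n b"
proof -
  let ?a = "attach_row n \<mu> b"
  have b0: "b (0, k) = \<nu> k" and le: "\<mu> (Suc k) \<le> \<nu> k" "\<nu> k \<le> \<mu> k" if "k < n" for k
    using that b \<nu> by (auto simp: GT_with_row_def PiE_iff)
  \<comment> \<open>The range includes \<open>i = Suc j\<close>: the boundary value \<open>M\<close>
    sits just above the diagonal and is preserved by the shift.\<close>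
  have entry: "gt_entry M ?a (Suc i) (Suc j) = gt_entry M b i j" if "i \<le> Suc j" "j < n" for i j
    using that by (auto simp: gt_entry_def)
  have fact: "gt_factor t ?a (Suc i) (Suc j) =
      (if i = 0 then gt_factor t ?a 1 (Suc j) else gt_factor t b i j)" if ij: "i \<le> j" "j < n" for i j
  proof (cases i)
    case (Suc i')
    moreover then obtain j' where "j = Suc j'" using ij by (cases j) auto
    ultimately show ?thesis using ij by (simp add: gt_factor_def)
  qed simp
  have gamma: "gt_gamma M t ?a (Suc i) (Suc j) =
      (if i = 0 then gt_factor t ?a 1 (Suc j) else 1) * gt_gamma M t b i j" if "i \<le> j" "j < n" for i j
  proof (cases i)
    case 0
    have "gt_factor t b 0 j = 1" by (simp add: gt_factor_def)
    thus ?thesis using that entry[of 0 j] entry[of 1 j] 0 by (simp add: gt_gamma_def)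
  next
    case (Suc i')
    thus ?thesis using that fact[OF that] entry[of i j] entry[of "Suc i" j] by (simp add: gt_gamma_def)
  qed
  \<comment> \<open>The gamma of the bottom entry \<open>\<mu> (Suc k)\<close> is paired with the
    factor of the entry \<open>\<nu> k\<close> above it: together they depend only on
    \<open>\<mu> k\<close>, \<open>\<nu> k\<close> and \<open>\<mu> (Suc k)\<close>.\<close>
  have gamma0: "gt_gamma M t ?a 0 (Suc k) * gt_factor t ?a 1 (Suc k) =
      t powi (\<nu> k - \<mu> (Suc k) - 1) * edge_weight t (\<mu> k) (\<mu> (Suc k)) (\<nu> k)" if "k < n" for k
  proof (cases "\<nu> k = \<mu> (Suc k)")
    case True
    thus ?thesis using that b0[OF that] strict[OF that] t
      by (simp add: gt_gamma_def gt_factor_def gt_entry_def edge_weight_def power_int_minus)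
  next
    case False
    hence "max (\<nu> k - \<mu> (Suc k) - 1) 0 = \<nu> k - \<mu> (Suc k) - 1" using le(1)[OF that] by simp
    thus ?thesis using False that b0[OF that]
      by (auto simp: gt_gamma_def gt_factor_def gt_entry_def edge_weight_def)
  qed
  have "pattern_weight M t (Suc n) ?a =
      gt_gamma M t ?a 0 0 * (\<Prod>k<n. gt_gamma M t ?a 0 (Suc k)) *
      (\<Prod>i<n. \<Prod>j = i..<n. (if i = 0 then gt_factor t ?a 1 (Suc j) else 1) * gt_gamma M t b i j)"
    unfolding pattern_weight_def prod.atLeast0_lessThan_Suc_shift o_def prod.shift_bounds_Suc_ivl
    unfolding atLeast0LessThan
    by (intro arg_cong2[where f = "(*)"] refl prod.cong gamma) auto
  also have "(\<Prod>i<n. \<Prod>j = i..<n. (if i = 0 then gt_factor t ?a 1 (Suc j) else 1) * gt_gamma M t b i j) =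
      (\<Prod>k<n. gt_factor t ?a 1 (Suc k)) * pattern_weight M t n b"
  proof -
    have "(\<Prod>i<n. \<Prod>j = i..<n. if i = 0 then gt_factor t ?a 1 (Suc j) else 1) =
        (\<Prod>i<n. if i = 0 then \<Prod>k<n. gt_factor t ?a 1 (Suc k) else 1)"
      by (intro prod.cong) (auto simp: atLeast0LessThan)
    also have "\<dots> = (\<Prod>k<n. gt_factor t ?a 1 (Suc k))"
      by (cases "n = 0") (simp_all add: prod.delta)
    finally have "(\<Prod>i<n. \<Prod>j = i..<n. if i = 0 then gt_factor t ?a 1 (Suc j) else 1) =
        (\<Prod>k<n. gt_factor t ?a 1 (Suc k))" .
    thus ?thesis by (simp add: prod.distrib pattern_weight_def atLeast0LessThan)
  qed
  \<comment> \<open>The entry above \<open>\<mu> 0\<close> is \<open>M\<close> by convention, and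
    \<open>\<mu> 0 < int M\<close> makes the truncation at 0 harmless.\<close>
  also have "gt_gamma M t ?a 0 0 = t powi (int M - \<mu> 0 - 1)"
    using M by (simp add: gt_gamma_def gt_entry_def gt_factor_def)
  finally have "pattern_weight M t (Suc n) ?a = t powi (int M - \<mu> 0 - 1) *
      (\<Prod>k<n. gt_gamma M t ?a 0 (Suc k) * gt_factor t ?a 1 (Suc k)) * pattern_weight M t n b"
    by (simp add: prod.distrib mult_ac)
  moreover have "(\<Prod>k<n. gt_gamma M t ?a 0 (Suc k) * gt_factor t ?a 1 (Suc k)) =
      t powi ((\<Sum>k<n. \<nu> k) - (\<Sum>k<n. \<mu> (Suc k)) - int n) *
      (\<Prod>k<n. edge_weight t (\<mu> k) (\<mu> (Suc k)) (\<nu> k))"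
    by (subst prod.cong[OF refl gamma0]) (simp_all add: prod.distrib prod_powi[OF t] sum_subtractf)
  moreover have "t powi (int M - int n - 1 + (\<Sum>k<n. \<nu> k) - (\<Sum>k<Suc n. \<mu> k)) =
      t powi (int M - \<mu> 0 - 1) * t powi ((\<Sum>k<n. \<nu> k) - (\<Sum>k<n. \<mu> (Suc k)) - int n)"
    unfolding power_int_add[OF disjI1[OF t], symmetric] sum.lessThan_Suc_shift
    by (simp add: algebra_simps)
  ultimately show ?thesis by (simp only: mult.assoc)
qed

lemma pattern_sum_Suc:
  assumes "t \<noteq> 0" "\<And>k. k < n \<Longrightarrow> \<mu> (Suc k) < \<mu> k" "\<mu> 0 < int M"
  shows "pattern_sum M t z (Suc n) \<mu> =
    (\<Sum>\<nu>\<in>interlacing n \<mu>. t powi (int M - int n - 1 + (\<Sum>k<n. \<nu> k) - (\<Sum>k<Suc n. \<mu> k)) *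
      (\<Prod>k<n. edge_weight t (\<mu> k) (\<mu> (Suc k)) (\<nu> k)) *
      z (Suc n) powi ((\<Sum>k<Suc n. \<mu> k) - (\<Sum>k<n. \<nu> k)) * pattern_sum M t z n \<nu>)"
proof -
  have "pattern_sum M t z (Suc n) \<mu> = (\<Sum>\<nu>\<in>interlacing n \<mu>. \<Sum>b\<in>GT_with_row n \<nu>.
      pattern_weight M t (Suc n) (attach_row n \<mu> b) * pattern_monom z (Suc n) (attach_row n \<mu> b))"
    unfolding pattern_sum_def by (rule sum_GT_with_row_Suc) (rule assms(2))
  also have "\<dots> = (\<Sum>\<nu>\<in>interlacing n \<mu>. \<Sum>b\<in>GT_with_row n \<nu>.
      t powi (int M - int n - 1 + (\<Sum>k<n. \<nu> k) - (\<Sum>k<Suc n. \<mu> k)) *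
      (\<Prod>k<n. edge_weight t (\<mu> k) (\<mu> (Suc k)) (\<nu> k)) *
      z (Suc n) powi ((\<Sum>k<Suc n. \<mu> k) - (\<Sum>k<n. \<nu> k)) *
      (pattern_weight M t n b * pattern_monom z n b))"
    using pattern_weight_attach_row[of t n \<mu> M] pattern_monom_attach_row[of _ n _ z \<mu>] assms
    by (intro sum.cong refl) (simp add: mult_ac del: sum.lessThan_Suc)
  finally show ?thesis by (simp add: pattern_sum_def sum_distrib_left del: sum.lessThan_Suc)
qed

section \<open>Induction on the number of variables\<close>

definition pairs :: "nat \<Rightarrow> (nat \<times> nat) set" where
  "pairs n = {(j, k). 1 \<le> j \<and> j < k \<and> k \<le> n}"

lemma finite_pairs: "finite (pairs n)"
  by (rule finite_subset[of _ "{..n} \<times> {..n}"]) (auto simp: pairs_def)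

lemma prod_pairs_Suc:
  "(\<Prod>(j, k)\<in>pairs (Suc n). f j k) = (\<Prod>(j, k)\<in>pairs n. f j k) * (\<Prod>j<n. f (Suc j) (Suc n))"
proof -
  have "pairs (Suc n) = pairs n \<union> (\<lambda>j. (Suc j, Suc n)) ` {..<n}"
    by (auto simp: pairs_def image_iff le_Suc_eq) (metis Suc_le_D Suc_less_eq lessThan_iff)
  moreover have "pairs n \<inter> (\<lambda>j. (Suc j, Suc n)) ` {..<n} = {}" by (auto simp: pairs_def)
  ultimately show ?thesis
    by (simp add: prod.union_disjoint finite_pairs prod.reindex inj_on_def)
qed

text \<open>
  Weakly decreasing \<open>\<mu>\<close> are admitted so that the induction hypothesis covers every interlacing row;
  both sides are 0 when \<open>\<mu>\<close> is not strict.
\<close>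

theorem tokuyama:
  fixes z :: "nat \<Rightarrow> 'b::field"
  assumes nz: "\<And>i. z i \<noteq> 0" and t: "t \<noteq> 0"
    and dec: "\<And>k. Suc k < n \<Longrightarrow> \<mu> (Suc k) \<le> \<mu> k" and M: "0 < n \<Longrightarrow> \<mu> 0 < int M"
  shows "(\<Prod>(j, k)\<in>pairs n. z j - z k) * pattern_sum M t z n \<mu> =
    t powi (\<Sum>k<n. int M - int k - 1 - \<mu> k) * (\<Prod>(j, k)\<in>pairs n. z j + t * z k) * alternant n z \<mu>"
  using dec M
proof (induction n arbitrary: \<mu>)
  case 0
  have [simp]: "pairs 0 = {}" by (auto simp: pairs_def)
  show ?case
    by (simp add: pattern_sum_def GT_with_row_0 pattern_weight_def pattern_monom_def alternant_def
        det_dim_zero)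
next
  case (Suc n)
  show ?case
  proof (cases "\<forall>k<n. \<mu> (Suc k) < \<mu> k")
    case False
    then obtain k where k: "k < n" "\<not> \<mu> (Suc k) < \<mu> k" by blast
    with Suc.prems(1)[of k] have "alternant (Suc n) z \<mu> = 0"
      by (intro alternant_eq_0[of k "Suc k"]) auto
    with k show ?thesis by (simp add: pattern_sum_def GT_with_row_not_strict[of k])
  next
    case True
    let ?V = "\<lambda>n. \<Prod>(j, k)\<in>pairs n. z j - z k" and ?Q = "\<lambda>n. \<Prod>(j, k)\<in>pairs n. z j + t * z k"
    let ?e = "\<lambda>\<nu>. \<Prod>k<n. edge_weight t (\<mu> k) (\<mu> (Suc k)) (\<nu> k)"
    let ?y = "\<lambda>\<nu>. z (Suc n) powi ((\<Sum>k<Suc n. \<mu> k) - (\<Sum>k<n. \<nu> k))"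
    let ?T = "t powi (\<Sum>k<Suc n. int M - int k - 1 - \<mu> k)"
    have IH: "t powi (int M - int n - 1 + (\<Sum>k<n. \<nu> k) - (\<Sum>k<Suc n. \<mu> k)) * (?V n * pattern_sum M t z n \<nu>) =
        ?T * ?Q n * alternant n z \<nu>" if \<nu>: "\<nu> \<in> interlacing n \<mu>" for \<nu>
    proof -
      have le: "\<mu> (Suc k) \<le> \<nu> k" "\<nu> k \<le> \<mu> k" if "k < n" for k
        using \<nu> that by (auto simp: PiE_iff)
      have "?V n * pattern_sum M t z n \<nu> =
          t powi (\<Sum>k<n. int M - int k - 1 - \<nu> k) * ?Q n * alternant n z \<nu>"
      proof (rule Suc.IH)
        \<comment> \<open>Interlacing gives
          \<open>\<nu> (Suc k) \<le> \<mu> (Suc k) \<le> \<nu> k\<close>.\<close>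
        show "\<nu> (Suc k) \<le> \<nu> k" if "Suc k < n" for k using le(1)[of k] le(2)[of "Suc k"] that by simp
        show "\<nu> 0 < int M" if "0 < n" using le(2)[OF that] Suc.prems(2) by simp
      qed
      \<comment> \<open>The sum of the \<open>\<nu> k\<close> cancels between the two exponents, so
        the power of \<open>t\<close> is the same for every \<open>\<nu>\<close> and leaves the
        sum.\<close>
      moreover have "?T = t powi (int M - int n - 1 + (\<Sum>k<n. \<nu> k) - (\<Sum>k<Suc n. \<mu> k)) *
          t powi (\<Sum>k<n. int M - int k - 1 - \<nu> k)"
        unfolding power_int_add[OF disjI1[OF t], symmetric] sum_subtractf by (simp add: algebra_simps)
      ultimately show ?thesis by (simp only: mult.assoc)
    qed
    \<comment> \<open>\<open>?V n\<close> moves inside the sum to meet the induction hypothesis; the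
      factors with the last variable stay outside for the branching identity.\<close>
    have "?V (Suc n) * pattern_sum M t z (Suc n) \<mu> =
        (\<Prod>j<n. z (Suc j) - z (Suc n)) * (\<Sum>\<nu>\<in>interlacing n \<mu>. ?e \<nu> * ?y \<nu> *
          (t powi (int M - int n - 1 + (\<Sum>k<n. \<nu> k) - (\<Sum>k<Suc n. \<mu> k)) * (?V n * pattern_sum M t z n \<nu>)))"
      using True Suc.prems(2)
      by (simp add: pattern_sum_Suc[OF t] prod_pairs_Suc sum_distrib_left mult_ac del: sum.lessThan_Suc)
    also have "\<dots> = ?T * ?Q n * ((\<Prod>j<n. z (Suc j) - z (Suc n)) *
        (\<Sum>\<nu>\<in>interlacing n \<mu>. ?e \<nu> * ?y \<nu> * alternant n z \<nu>))"
      by (subst sum.cong[OF refl arg_cong2[where f = "(*)", OF refl IH]])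
         (simp_all add: sum_distrib_left mult_ac del: sum.lessThan_Suc)
    also have "\<dots> = ?T * ?Q (Suc n) * alternant (Suc n) z \<mu>"
      using True by (subst alternant_branching[OF nz]) (simp_all add: prod_pairs_Suc mult_ac del: sum.lessThan_Suc)
    finally show ?thesis .
  qed
qed

section \<open>Specialization to indeterminates and Schur polynomials\<close>

lemma indet_eq_iff: "indet i = (indet j :: 'a::field mpoly fract) \<longleftrightarrow> i = j"
proof
  assume "indet i = (indet j :: 'a mpoly fract)"
  hence "Poly_Mapping.single (Poly_Mapping.single i (1::nat)) (1::'a) =
      Poly_Mapping.single (Poly_Mapping.single j 1) 1"
    by (simp add: indet_def)
  hence "Poly_Mapping.single i (1::nat) = Poly_Mapping.single j 1"
    by (metis lookup_single_eq lookup_single_not_eq one_neq_zero)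
  thus "i = j" by (metis lookup_single_eq lookup_single_not_eq one_neq_zero)
qed simp

lemma single_eq_0_iff: "Poly_Mapping.single k c = 0 \<longleftrightarrow> c = 0"
  by (metis lookup_single_eq lookup_zero single_zero)

lemma indet_neq_0: "indet i \<noteq> (0 :: 'a::field mpoly fract)"
  by (simp add: indet_def single_eq_0_iff)

lemma const_fract_eq_0_iff: "const_fract c = 0 \<longleftrightarrow> c = 0"
  by (simp add: const_fract_def single_eq_0_iff)

theorem theorem6p3:
  fixes N M :: nat
    and lam :: "nat \<Rightarrow> nat"
    and z :: "nat \<Rightarrow> 'a::field mpoly fract"
    and t :: 'a
    and T :: "'a mpoly fract"
  assumes "1 \<le> N" and "N \<le> M"
    and "is_young N lam" and "lam 1 \<le> M - N"
    and "t \<noteq> 0"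
  defines "z \<equiv> indet"
    and "T \<equiv> const_fract t"
  shows "(\<Prod>(j, k) \<in> {(j, k). 1 \<le> j \<and> j < k \<and> k \<le> N}. z j + T * z k) * schur N lam z =
    T powi ((\<Sum>j = 1..N. int (lam j)) - int N * (int M - int N)) *
    (\<Sum>a \<in> strict_dual_GT_bottom N lam.
       (\<Prod>i = 0..<N. \<Prod>j = i..<N. gt_gamma M T a i j) *
       ((\<Prod>i = 0..<N - 1. z (N - i) powi (row_sum N a i - row_sum N a (i + 1))) *
        z 1 powi row_sum N a (N - 1)))"
proof -
  define \<mu> where "\<mu> = (\<lambda>k. int (lam (k + 1)) + int N - int k - 1)"
  define V where "V = (\<Prod>(j, k)\<in>pairs N. z j - z k)"
  define Q where "Q = (\<Prod>(j, k)\<in>pairs N. z j + T * z k)"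
  define E where "E = int N * (int M - int N) - (\<Sum>j = 1..N. int (lam j))"
  have T: "T \<noteq> 0" using \<open>t \<noteq> 0\<close> by (simp add: T_def const_fract_eq_0_iff)
  have "z j - z k \<noteq> 0" if "j < k" for j k
    using that by (simp add: z_def indet_eq_iff)
  hence V: "V \<noteq> 0" by (auto simp: V_def finite_pairs) (auto simp: pairs_def)
  have "int M - int k - 1 - \<mu> k = int M - int N - int (lam (Suc k))" for k
    by (simp add: \<mu>_def)
  \<comment> \<open>The staircase in \<open>\<mu>\<close> cancels the terms
    \<open>- int k - 1\<close>, so each summand is
    \<open>int M - int N - int (lam (Suc k))\<close>.\<close>
  hence exponent: "(\<Sum>k<N. int M - int k - 1 - \<mu> k) = E"
    by (simp only: sum_subtractf) (simp add: E_def sum.atLeast1_atMost_eq algebra_simps)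
  have toku: "V * pattern_sum M T z N \<mu> = T powi E * Q * alternant N z \<mu>"
    unfolding V_def Q_def exponent[symmetric]
  proof (rule tokuyama)
    show "\<mu> (Suc k) \<le> \<mu> k" if "Suc k < N" for k
    proof -
      have "lam (Suc k + 1) \<le> lam (k + 1)"
        using \<open>is_young N lam\<close> that by (simp add: is_young_def)
      thus ?thesis by (simp add: \<mu>_def)
    qed
    \<comment> \<open>The first entry is \<open>lam 1 + N - 1\<close>, so the bound on
      \<open>lam 1\<close> is exactly what is required.\<close>
    show "\<mu> 0 < int M" using \<open>lam 1 \<le> M - N\<close> \<open>N \<le> M\<close> by (simp add: \<mu>_def)
  qed (simp_all add: T z_def indet_neq_0)
  \<comment> \<open>For \<open>k < N\<close> the natural subtraction does not truncate, so integer
    and natural powers agree.\<close>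
  have "z (Suc j) powi \<mu> k = z (Suc j) ^ (lam (Suc k) + N - Suc k)" if "k < N" for j k
  proof -
    have "\<mu> k = int (lam (Suc k) + N - Suc k)" using that by (simp add: \<mu>_def)
    thus ?thesis by simp
  qed
  hence "alternant N z \<mu> = det (mat N N (\<lambda>(j, k). z (j + 1) ^ (lam (k + 1) + N - (k + 1))))"
    unfolding alternant_def by (intro arg_cong[where f = det] cong_mat) simp_all
  hence schur: "schur N lam z = alternant N z \<mu> / V"
    by (simp add: schur_def V_def pairs_def)
  have "pattern_monom z N a = (\<Prod>i = 0..<N - 1. z (N - i) powi (row_sum N a i - row_sum N a (i + 1))) *
      z 1 powi row_sum N a (N - 1)" for a
    using \<open>1 \<le> N\<close> by (cases N) (simp_all add: pattern_monom_def row_sum_def)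
  hence "(\<Sum>a \<in> strict_dual_GT_bottom N lam.
       (\<Prod>i = 0..<N. \<Prod>j = i..<N. gt_gamma M T a i j) *
       ((\<Prod>i = 0..<N - 1. z (N - i) powi (row_sum N a i - row_sum N a (i + 1))) *
        z 1 powi row_sum N a (N - 1))) = pattern_sum M T z N \<mu>"
    by (simp add: pattern_sum_def pattern_weight_def strict_dual_GT_bottom_def GT_with_row_def \<mu>_def)
  moreover have "T powi ((\<Sum>j = 1..N. int (lam j)) - int N * (int M - int N)) = inverse (T powi E)"
    by (simp add: E_def flip: power_int_minus)
  moreover have "Q * (alternant N z \<mu> / V) = inverse (T powi E) * pattern_sum M T z N \<mu>"
    using toku T V by (simp add: field_simps)
  ultimately show ?thesis by (simp add: schur Q_def pairs_def)
qed

end
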